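(* Let $r\geqslant 3$ and let $s\geqslant t\geqslant 2$ be integers. Then $$\mathrm{ex}_{r}(n,K_{s,t}^{(r)})=O\left(n^{r-\frac{1}{t}}\right)$$ as $n\to\infty$.
   Context: An $r$-graph is an $r$-uniform hypergraph. For an $r$-graph $\mathcal{H}$, $\mathrm{ex}_{r}(n,\mathcal{H})$ is the maximum number of edges in an $n$-vertex $r$-graph containing no copy of $\mathcal{H}$ as a (not necessarily induced) subhypergraph. The complete bipartite $r$-graph $K_{s,t}^{(r)}$ is defined as follows: let $X_{1},\ldots,X_{t}$ be $t$ pairwise disjoint sets of size $r-1$, and let $Y$ be a set of $s$ elements disjoint from $\bigcup_{i=1}^{t}X_{i}$. Then $K_{s,t}^{(r)}$ has vertex set $\left(\bigcup_{i=1}^{t}X_{i}\right)\cup Y$ and edge set $\{X_{i}\cup\{y\}: 1\leqslant i\leqslant t,\ y\in Y\}$. (For $r\geqslant 3$ and $s\neq t$, $K_{s,t}^{(r)}$ and $K_{t,s}^{(r)}$ are not isomorphic.) Asymptotic notation is for $n\to\infty$ with $r,s,t$ fixed; the implied constant does not depend on $n$. *)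

theory Defs
  imports Complex_Main "HOL-Library.Landau_Symbols"
begin

type_synonym 'a hypergraph = "'a set \<times> 'a set set"

abbreviation verts :: "'a hypergraph \<Rightarrow> 'a set" where
  "verts H \<equiv> fst H"

abbreviation edges :: "'a hypergraph \<Rightarrow> 'a set set" where
  "edges H \<equiv> snd H"

definition r_graph :: "nat \<Rightarrow> 'a hypergraph \<Rightarrow> bool" where
  "r_graph r H \<longleftrightarrow> finite (verts H) \<and> (\<forall>e \<in> edges H. e \<subseteq> verts H \<and> card e = r)"

text \<open>Copies are not required to be induced: only edges have to be preserved.\<close>

definition contains_copy :: "'a hypergraph \<Rightarrow> 'b hypergraph \<Rightarrow> bool" where
  "contains_copy G H \<longleftrightarrow>
     (\<exists>f. inj_on f (verts H) \<and> f ` verts H \<subseteq> verts G \<and> (\<forall>e \<in> edges H. f ` e \<in> edges G))"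

text \<open>Every finite hypergraph is isomorphic to one whose vertices are natural numbers, so it
  suffices to let the host hypergraphs range over those. The set below is finite, and it is
  nonempty as soon as \<open>H\<close> has an edge; otherwise the maximum may be unspecified.\<close>

definition turan_number :: "nat \<Rightarrow> nat \<Rightarrow> 'b hypergraph \<Rightarrow> nat" where
  "turan_number r n H =
     Max {card (edges G) | G :: nat hypergraph.
            r_graph r G \<and> card (verts G) = n \<and> \<not> contains_copy G H}"

text \<open>The part \<open>X\<^sub>i\<close> consists of the vertices \<open>Inl (i, j)\<close> with \<open>j < r - 1\<close>, and
  \<open>Y\<close> of the vertices \<open>Inr y\<close> with \<open>y < s\<close>; the index \<open>i\<close> runs from \<open>0\<close> to \<open>t - 1\<close>.\<close>

definition part_X :: "nat \<Rightarrow> nat \<Rightarrow> (nat \<times> nat + nat) set" where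
  "part_X r i = (\<lambda>j. Inl (i, j)) ` {..<r - 1}"

definition part_Y :: "nat \<Rightarrow> (nat \<times> nat + nat) set" where
  "part_Y s = Inr ` {..<s}"

definition complete_bipartite :: "nat \<Rightarrow> nat \<Rightarrow> nat \<Rightarrow> (nat \<times> nat + nat) hypergraph" where
  "complete_bipartite r s t =
     ((\<Union>i<t. part_X r i) \<union> part_Y s, {part_X r i \<union> {y} | i y. i < t \<and> y \<in> part_Y s})"

lemma card_part_X: "card (part_X r i) = r - 1"
  by (simp add: part_X_def card_image inj_on_def)

lemma disjoint_part_X: "i \<noteq> k \<Longrightarrow> part_X r i \<inter> part_X r k = {}"
  by (auto simp: part_X_def)

lemma card_part_Y: "card (part_Y s) = s"
  by (simp add: part_Y_def card_image)

lemma disjoint_part_X_part_Y: "part_X r i \<inter> part_Y s = {}"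
  by (auto simp: part_X_def part_Y_def)

lemma r_graph_complete_bipartite:
  assumes "r \<ge> 1"
  shows "r_graph r (complete_bipartite r s t)"
proof -
  have "card (part_X r i \<union> {y}) = r" if "y \<in> part_Y s" for i y
  proof -
    have "finite (part_X r i)" "y \<notin> part_X r i"
      using that by (auto simp: part_X_def part_Y_def)
    then show ?thesis
      using assms by (simp add: card_part_X)
  qed
  then show ?thesis
    by (fastforce simp: r_graph_def complete_bipartite_def part_X_def part_Y_def)
qed

lemma finite_turan_set:
  "finite {card (edges G) | G :: nat hypergraph.
             r_graph r G \<and> card (verts G) = n \<and> \<not> contains_copy G H}"
proof (rule finite_subset)
  show "{card (edges G) | G :: nat hypergraph.
          r_graph r G \<and> card (verts G) = n \<and> \<not> contains_copy G H} \<subseteq> {..2 ^ n}"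
  proof safe
    fix V :: "nat set" and E
    assume "r_graph r (V, E)"
    then have "finite V" "E \<subseteq> Pow V"
      by (auto simp: r_graph_def)
    then show "card (edges (V, E)) \<le> 2 ^ card (verts (V, E))"
      using card_mono[of "Pow V" E] by (simp add: card_Pow)
  qed
qed simp

lemma turan_set_nonempty:
  assumes "edges H \<noteq> {}"
  shows "{card (edges G) | G :: nat hypergraph.
            r_graph r G \<and> card (verts G) = n \<and> \<not> contains_copy G H} \<noteq> {}"
proof -
  have "r_graph r ({..<n}, {})" "card (verts ({..<n}, {})) = n"
       "\<not> contains_copy ({..<n}, {}) H"
    using assms by (auto simp: r_graph_def contains_copy_def)
  then show ?thesis
    by blast
qed

end

theory Submission
  imports Defs
begin

text \<open>Call a \<open>t\<close>-tuple of pairwise disjoint \<open>(r - 1)\<close>-sets seen by a vertex \<open>y\<close> if all its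
  members lie in the link of \<open>y\<close>. A hypergraph without the forbidden copy lets every tuple be
  seen by fewer than \<open>s\<close> vertices, so at most \<open>s n\<^bsup>(r - 1) t\<^esup>\<close> pairs of a vertex and a seen tuple
  exist. On the other hand, choosing the members greedily shows that a vertex of degree \<open>d\<close> sees
  at least \<open>(d - a)\<^sup>t\<close> tuples, where \<open>a = O(n\<^bsup>r - 2\<^esup>)\<close> bounds the number of link edges that meet
  the members already chosen. As in the theorem of Kovari, Sos and Turan, convexity then
  bounds the sum of all degrees; it enters through \<open>x \<le> m + x\<^sup>t / m\<^bsup>t - 1\<^esup>\<close>.\<close>

section \<open>Subsets of a given size\<close>

lemma card_subsets_le_power:
  assumes "finite V"
  shows "card {X. X \<subseteq> V \<and> card X = k} \<le> card V ^ k"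
proof (cases "k \<le> card V")
  case True
  then show ?thesis
    using assms by (simp add: n_subsets binomial_le_pow)
next
  case False
  then show ?thesis
    using assms by (simp add: n_subsets binomial_eq_0)
qed

text \<open>Deleting \<open>x\<close> is injective on these sets and lands in the subsets of size
  \<open>k - 1\<close>. With \<open>k = r - 1\<close> this bounds the number of link edges through
  one vertex.\<close>

lemma card_subsets_containing_le_power:
  assumes "finite V"
  shows "card {X. X \<subseteq> V \<and> card X = k \<and> x \<in> X} \<le> card V ^ (k - 1)"
proof -
  let ?A = "{X. X \<subseteq> V \<and> card X = k \<and> x \<in> X}" and ?B = "{X. X \<subseteq> V \<and> card X = k - 1}"
  have "finite ?B"
    by (rule finite_subset[of _ "Pow V"]) (use assms in auto)
  moreover have "(\<lambda>X. X - {x}) ` ?A \<subseteq> ?B"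
    by (auto dest: finite_subset[OF _ assms])
  moreover have "inj_on (\<lambda>X. X - {x}) ?A"
    by (rule inj_on_inverseI[of _ "insert x"]) auto
  ultimately have "card ?A \<le> card ?B"
    by (intro card_inj_on_le)
  also have "\<dots> \<le> card V ^ (k - 1)"
    by (rule card_subsets_le_power[OF assms])
  finally show ?thesis .
qed

section \<open>Ordered tuples of pairwise disjoint sets\<close>

definition disjoint_tuples :: "'a set set \<Rightarrow> nat \<Rightarrow> 'a set list set" where
  "disjoint_tuples F t = {xs. length xs = t \<and> set xs \<subseteq> F \<and> sorted_wrt disjnt xs}"

lemma finite_disjoint_tuples: "finite F \<Longrightarrow> finite (disjoint_tuples F t)"
  unfolding disjoint_tuples_def
  by (rule finite_subset[OF _ finite_lists_length_eq[of F t]]) auto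

text \<open>Tuples are lists so that they can be counted one entry at a time: attaching the head is
  injective, so the count for length \<open>Suc t\<close> becomes a sum over the tuples of length
  \<open>t\<close>.\<close>

lemma disjoint_tuples_Suc:
  "disjoint_tuples F (Suc t) =
     (\<lambda>(xs, X). X # xs) ` (SIGMA xs : disjoint_tuples F t. {X \<in> F. disjnt X (\<Union>(set xs))})"
  (is "?L = ?R")
proof
  show "?L \<subseteq> ?R"
  proof
    fix ys assume "ys \<in> ?L"
    moreover from this obtain X xs where "ys = X # xs"
      by (cases ys) (auto simp: disjoint_tuples_def)
    ultimately show "ys \<in> ?R"
      by (intro image_eqI[of _ _ "(xs, X)"]) (auto simp: disjoint_tuples_def)
  qed
  show "?R \<subseteq> ?L"
    by (auto simp: disjoint_tuples_def)
qed

text \<open>The entries chosen so far cover at most \<open>m * k\<close> points and each point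
  excludes at most \<open>\<Delta>\<close> sets, so every step leaves at least
  \<open>card F - m * k * \<Delta>\<close> choices. The separate bound \<open>m\<close> on the
  length keeps this number the same throughout the induction.\<close>

lemma card_disjoint_tuples_ge:
  fixes \<Delta> k m t :: nat
  assumes "finite F"
    and size: "\<And>X. X \<in> F \<Longrightarrow> card X \<le> k \<and> finite X"
    and degree: "\<And>x. card {X \<in> F. x \<in> X} \<le> \<Delta>"
    and "t \<le> m"
  shows "(card F - m * k * \<Delta>) ^ t \<le> card (disjoint_tuples F t)"
  using \<open>t \<le> m\<close>
proof (induction t)
  case 0
  have "disjoint_tuples F 0 = {[]}"
    by (auto simp: disjoint_tuples_def)
  then show ?case by simp
next
  case (Suc t)
  let ?ext = "\<lambda>xs. {X \<in> F. disjnt X (\<Union>(set xs))}"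
  have ext: "card F - m * k * \<Delta> \<le> card (?ext xs)" if xs: "xs \<in> disjoint_tuples F t" for xs
  proof -
    have fin: "finite (\<Union>(set xs))"
      using xs size by (auto simp: disjoint_tuples_def)
    have "card (\<Union>(set xs)) \<le> (\<Sum>X\<in>set xs. card X)"
      by (metis card_Union_le_sum_card)
    also have "\<dots> \<le> card (set xs) * k"
      using sum_bounded_above[of "set xs" card k] xs size by (auto simp: disjoint_tuples_def)
    also have "\<dots> \<le> m * k"
      using card_length[of xs] xs Suc.prems by (intro mult_right_mono) (auto simp: disjoint_tuples_def)
    finally have union: "card (\<Union>(set xs)) \<le> m * k" .
    \<comment> \<open>A set is lost only if it contains a point of the union, so a union bound over
      these points suffices.\<close>
    have "card (F - ?ext xs) \<le> card (\<Union>x\<in>\<Union>(set xs). {X \<in> F. x \<in> X})"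
      by (rule card_mono[OF finite_subset[OF _ \<open>finite F\<close>]]) (auto simp: disjnt_def)
    also have "\<dots> \<le> (\<Sum>x\<in>\<Union>(set xs). card {X \<in> F. x \<in> X})"
      by (rule card_UN_le[OF fin])
    also have "\<dots> \<le> card (\<Union>(set xs)) * \<Delta>"
      using sum_bounded_above[of "\<Union>(set xs)" "\<lambda>x. card {X \<in> F. x \<in> X}" \<Delta>] degree by simp
    also have "\<dots> \<le> m * k * \<Delta>"
      using union by (rule mult_right_mono) simp
    finally have "card (F - ?ext xs) \<le> m * k * \<Delta>" .
    moreover have "card (F - ?ext xs) = card F - card (?ext xs)"
      by (rule card_Diff_subset) (use \<open>finite F\<close> in auto)
    ultimately show ?thesis by linarith
  qed
  have "(card F - m * k * \<Delta>) ^ Suc t \<le> card (disjoint_tuples F t) * (card F - m * k * \<Delta>)"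
    using Suc by (simp add: mult.commute mult_left_mono)
  also have "\<dots> \<le> (\<Sum>xs\<in>disjoint_tuples F t. card (?ext xs))"
    using sum_bounded_below[of "disjoint_tuples F t" "card F - m * k * \<Delta>" "\<lambda>xs. card (?ext xs)"] ext
    by simp
  also have "\<dots> = card (SIGMA xs : disjoint_tuples F t. ?ext xs)"
    using \<open>finite F\<close> by (simp add: card_SigmaI finite_disjoint_tuples)
  also have "\<dots> = card (disjoint_tuples F (Suc t))"
    unfolding disjoint_tuples_Suc by (rule card_image[symmetric]) (auto simp: inj_on_def)
  finally show ?case .
qed

section \<open>Links and copies of the complete bipartite hypergraph\<close>

definition link :: "'a set set \<Rightarrow> 'a \<Rightarrow> 'a set set" where
  "link E y = {X. y \<notin> X \<and> insert y X \<in> E}"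

text \<open>The entries of \<open>xs\<close> take the role of the sets \<open>part_X r i\<close>,
  and \<open>s\<close> elements of \<open>Y\<close> that of \<open>part_Y s\<close>. The edges are
  present because every entry lies in the link of every element of \<open>Y\<close>; what remains is
  injectivity.\<close>

lemma contains_copy_complete_bipartite:
  fixes G :: "'a hypergraph"
  assumes "r \<ge> 1" and "r_graph r G" and "length xs = t" and disj: "sorted_wrt disjnt xs"
    and "s \<le> card Y" and "Y \<subseteq> verts G" and link: "\<And>y. y \<in> Y \<Longrightarrow> set xs \<subseteq> link (edges G) y"
    and "s \<ge> 1"
  shows "contains_copy G (complete_bipartite r s t)"
proof -
  obtain Z where "Z \<subseteq> Y" "card Z = s" "finite Z"
    using obtain_subset_with_card_n[OF \<open>s \<le> card Y\<close>] by metis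
  then obtain h where h: "bij_betw h {..<s} Z"
    using ex_bij_betw_nat_finite by (metis atLeast0LessThan)
  have hY: "h y \<in> Y" if "y < s" for y
    using h \<open>Z \<subseteq> Y\<close> that by (auto simp: bij_betw_def)
  have star: "h y \<notin> xs ! i" "insert (h y) (xs ! i) \<in> edges G" if "i < t" "y < s" for i y
  proof -
    have "xs ! i \<in> link (edges G) (h y)"
      using link[OF hY[OF that(2)]] that(1) \<open>length xs = t\<close> by auto
    then show "h y \<notin> xs ! i" "insert (h y) (xs ! i) \<in> edges G"
      by (simp_all add: link_def)
  qed
  \<comment> \<open>A single edge, the one through \<open>h 0\<close>, shows that
    \<open>xs ! i\<close> is an \<open>(r - 1)\<close>-set of vertices; this is where
    \<open>s \<ge> 1\<close> enters.\<close>
  have part: "finite (xs ! i)" "card (xs ! i) = r - 1" "xs ! i \<subseteq> verts G" if "i < t" for i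
  proof -
    have e: "h 0 \<notin> xs ! i" "insert (h 0) (xs ! i) \<in> edges G"
      using star[of i 0] that \<open>s \<ge> 1\<close> by auto
    then have "insert (h 0) (xs ! i) \<subseteq> verts G" "card (insert (h 0) (xs ! i)) = r" "finite (verts G)"
      using \<open>r_graph r G\<close> by (auto simp: r_graph_def)
    then show "finite (xs ! i)" "card (xs ! i) = r - 1" "xs ! i \<subseteq> verts G"
      using e(1) by (auto dest: finite_subset)
  qed
  have "\<exists>g. bij_betw g {..<r - 1} (xs ! i)" if "i < t" for i
    using part[OF that] by (metis atLeast0LessThan ex_bij_betw_nat_finite)
  then obtain g where g: "\<And>i. i < t \<Longrightarrow> bij_betw (g i) {..<r - 1} (xs ! i)"
    by metis
  \<comment> \<open>The embedding glues bijections onto the single parts. Clashes between parts are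
    excluded in \<open>gh\<close> by \<open>y \<notin> X\<close> in the link, and in
    \<open>gg\<close> by disjointness.\<close>
  define f where "f = case_sum (\<lambda>(i, j). g i j) h"
  have f_X: "f ` part_X r i = xs ! i" if "i < t" for i
    using g[OF that] by (auto simp: f_def part_X_def bij_betw_def image_image)
  have f_simps: "f (Inl (i, j)) = g i j" "f (Inr y) = h y" for i j y
    by (simp_all add: f_def)
  have g_mem: "g i j \<in> xs ! i" if "i < t" "j < r - 1" for i j
    using g[OF that(1)] that(2) by (auto simp: bij_betw_def)
  have gh: "g i j \<noteq> h y" if "i < t" "j < r - 1" "y < s" for i j y
    using star(1)[OF that(1,3)] g_mem[OF that(1,2)] by auto
  have gg: "i = i' \<and> j = j'"
    if eq: "g i j = g i' j'" and "i < t" "j < r - 1" "i' < t" "j' < r - 1" for i j i' j'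
  proof -
    \<comment> \<open>Both orders are needed, since \<open>sorted_wrt\<close> only speaks of an
      earlier and a later entry.\<close>
    have "\<not> disjnt (xs ! i) (xs ! i')" "\<not> disjnt (xs ! i') (xs ! i)"
      using g_mem[of i j] g_mem[of i' j'] that by (auto simp: disjnt_def)
    then have "i = i'"
      using disj that \<open>length xs = t\<close> by (metis linorder_neqE_nat sorted_wrt_nth_less)
    then show ?thesis
      using g[of i] that by (auto simp: bij_betw_def inj_on_def)
  qed
  have hh: "y = y'" if "h y = h y'" "y < s" "y' < s" for y y'
    using h that by (auto simp: bij_betw_def inj_on_def)
  have "inj_on f (verts (complete_bipartite r s t))"
    by (rule inj_onI)
      (auto simp: complete_bipartite_def part_X_def part_Y_def f_simps gh gh[symmetric]
        dest: gg[simplified] hh)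
  moreover have "f ` verts (complete_bipartite r s t) \<subseteq> verts G"
    using part(3) f_X hY \<open>Y \<subseteq> verts G\<close>
    by (fastforce simp: complete_bipartite_def part_Y_def f_simps)
  moreover have "f ` e \<in> edges G" if "e \<in> edges (complete_bipartite r s t)" for e
  proof -
    obtain i y where iy: "i < t" "y < s" "e = part_X r i \<union> {Inr y}"
      using \<open>e \<in> _\<close> by (auto simp: complete_bipartite_def part_Y_def)
    then have "f ` e = insert (h y) (xs ! i)"
      using f_X by (simp add: f_simps image_Un)
    then show ?thesis
      using star(2)[OF iy(1,2)] by simp
  qed
  ultimately show ?thesis
    unfolding contains_copy_def by blast
qed

section \<open>Sums over the vertices: edges and seen tuples\<close>

lemma card_edges_le_sum_link:
  assumes "r_graph r G" and "r \<ge> 1"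
  shows "card (edges G) \<le> (\<Sum>y\<in>verts G. card (link (edges G) y))"
proof -
  have fin: "finite (verts G)" and E: "\<And>e. e \<in> edges G \<Longrightarrow> e \<subseteq> verts G \<and> card e = r"
    using assms by (auto simp: r_graph_def)
  have finE: "finite (edges G)"
    by (rule finite_subset[of _ "Pow (verts G)"]) (use fin E in auto)
  have finL: "finite (link (edges G) y)" for y
    by (rule finite_subset[of _ "Pow (verts G)"]) (use fin E in \<open>auto simp: link_def\<close>)
  \<comment> \<open>As \<open>r \<ge> 1\<close>, every edge is nonempty and arises from the link of
    each of its vertices. One of them is enough, at the cost of a factor \<open>r\<close>.\<close>
  have "edges G \<subseteq> (\<Union>y\<in>verts G. insert y ` link (edges G) y)"
  proof
    fix e assume "e \<in> edges G"
    moreover from this obtain y where "y \<in> e"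
      using E assms(2) by (metis card.empty equals0I not_one_le_zero)
    ultimately have "y \<in> verts G" "e - {y} \<in> link (edges G) y" "e = insert y (e - {y})"
      using E by (auto simp: link_def insert_absorb)
    then show "e \<in> (\<Union>y\<in>verts G. insert y ` link (edges G) y)"
      by blast
  qed
  then have "card (edges G) \<le> card (\<Union>y\<in>verts G. insert y ` link (edges G) y)"
    by (rule card_mono[rotated]) (use fin finL in auto)
  also have "\<dots> \<le> (\<Sum>y\<in>verts G. card (insert y ` link (edges G) y))"
    by (rule card_UN_le[OF fin])
  also have "\<dots> \<le> (\<Sum>y\<in>verts G. card (link (edges G) y))"
    by (rule sum_mono) (rule card_image_le[OF finL])
  finally show ?thesis .
qed

lemma sum_card_disjoint_tuples_link_le:
  fixes G :: "'a hypergraph"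
  assumes "r \<ge> 1" and "s \<ge> 1" and "t \<ge> 1" and G: "r_graph r G"
    and free: "\<not> contains_copy G (complete_bipartite r s t)"
  shows "(\<Sum>y\<in>verts G. card (disjoint_tuples (link (edges G) y) t)) \<le> s * card (verts G) ^ ((r - 1) * t)"
proof -
  let ?F = "{X. X \<subseteq> verts G \<and> card X = r - 1}"
  let ?U = "disjoint_tuples ?F t" and ?P = "\<lambda>xs y. set xs \<subseteq> link (edges G) y"
  have fin: "finite (verts G)" and E: "\<And>e. e \<in> edges G \<Longrightarrow> e \<subseteq> verts G \<and> card e = r"
    using G by (auto simp: r_graph_def)
  have finF: "finite ?F"
    by (rule finite_subset[of _ "Pow (verts G)"]) (use fin in auto)
  have linkF: "link (edges G) y \<subseteq> ?F" for y
    using E fin by (fastforce simp: link_def dest: finite_subset)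
  \<comment> \<open>This places the tuples of all vertices in the common index set
    \<open>?U\<close>, so that the order of summation can be exchanged.\<close>
  have tuples: "disjoint_tuples (link (edges G) y) t = {xs \<in> ?U. ?P xs y}" for y
    using linkF[of y] by (auto simp: disjoint_tuples_def)
  have seen: "card {y \<in> verts G. ?P xs y} \<le> s" if "xs \<in> ?U" for xs
  proof (rule ccontr)
    assume "\<not> card {y \<in> verts G. ?P xs y} \<le> s"
    then have "contains_copy G (complete_bipartite r s t)"
      using that assms
      by (intro contains_copy_complete_bipartite[of r G xs t s "{y \<in> verts G. ?P xs y}"])
        (auto simp: disjoint_tuples_def)
    with free show False ..
  qed
  have "(\<Sum>y\<in>verts G. card (disjoint_tuples (link (edges G) y) t))
      = (\<Sum>y\<in>verts G. \<Sum>xs | xs \<in> ?U \<and> ?P xs y. 1)"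
    by (simp add: tuples)
  also have "\<dots> = (\<Sum>xs\<in>?U. \<Sum>y | y \<in> verts G \<and> ?P xs y. 1)"
    by (rule sum.swap_restrict[OF fin finite_disjoint_tuples[OF finF]])
  also have "\<dots> \<le> card ?U * s"
    using sum_bounded_above[of ?U "\<lambda>xs. card {y \<in> verts G. ?P xs y}" s] seen by simp
  \<comment> \<open>Disjointness is dropped: the number of all lists already has the right
    order.\<close>
  also have "card ?U \<le> card {xs. set xs \<subseteq> ?F \<and> length xs = t}"
    by (rule card_mono[OF finite_lists_length_eq[OF finF]]) (auto simp: disjoint_tuples_def)
  also have "\<dots> = card ?F ^ t"
    by (rule card_lists_length_eq[OF finF])
  also have "\<dots> \<le> (card (verts G) ^ (r - 1)) ^ t"
    by (rule power_mono[OF card_subsets_le_power[OF fin]]) simp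
  finally show ?thesis
    by (simp add: power_mult mult.commute[of _ s])
qed

section \<open>From seen tuples to the number of edges\<close>

lemma le_add_power_divide_power:
  fixes x m :: real
  assumes "x \<ge> 0" and "m > 0" and "t \<ge> 1"
  shows "x \<le> m + x ^ t / m ^ (t - 1)"
proof (cases "x \<le> m")
  case True
  then show ?thesis
    using assms by (intro add_increasing2) auto
next
  case False
  \<comment> \<open>For \<open>x > m\<close> the factor \<open>(x / m) ^ (t - 1)\<close> is at least
    1, so multiplying \<open>x\<close> by it does not decrease it.\<close>
  then have "x * m ^ (t - 1) \<le> x * x ^ (t - 1)"
    using assms by (intro mult_left_mono power_mono) auto
  also have "\<dots> = x ^ t"
    using assms by (metis One_nat_def Suc_le_D diff_Suc_1 power_Suc)
  finally have "x \<le> x ^ t / m ^ (t - 1)"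
    using assms by (simp add: pos_le_divide_eq)
  then show ?thesis
    using assms by linarith
qed

text \<open>Summing over the vertices yields three terms, from \<open>a\<close>, from
  \<open>m\<close> and from the seen tuples. The choice of \<open>m\<close> balances the last two,
  and the three contribute \<open>t * r\<close>, \<open>1\<close> and \<open>s\<close> to the
  constant.\<close>

lemma card_edges_le_if_complete_bipartite_free:
  fixes G :: "'a hypergraph"
  assumes "r \<ge> 2" and "s \<ge> 1" and "t \<ge> 1" and G: "r_graph r G" and "card (verts G) = n"
    and free: "\<not> contains_copy G (complete_bipartite r s t)" and "n \<ge> 1"
  shows "real (card (edges G)) \<le> real (t * r + s + 1) * real n powr (real r - 1 / real t)"
proof -
  \<comment> \<open>The greedy loss: at most \<open>t\<close> entries with \<open>r - 1\<close>
    points each, and at most \<open>n ^ (r - 2)\<close> link edges through a point.\<close>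
  define a where "a = t * (r - 1) * n ^ (r - 2)"
  define d where "d y = card (link (edges G) y)" for y
  define p where "p = real r - 1 / real t"
  \<comment> \<open>the average degree of an extremal example, up to a constant\<close>
  define m where "m = real n powr (p - 1)"
  have fin: "finite (verts G)" and E: "\<And>e. e \<in> edges G \<Longrightarrow> e \<subseteq> verts G \<and> card e = r"
    using G by (auto simp: r_graph_def)
  have mpos: "m > 0"
    using \<open>n \<ge> 1\<close> by (simp add: m_def)
  have tuples: "(d y - a) ^ t \<le> card (disjoint_tuples (link (edges G) y) t)" for y
    unfolding a_def d_def
  proof (rule card_disjoint_tuples_ge)
    show "finite (link (edges G) y)"
      by (rule finite_subset[of _ "Pow (verts G)"]) (use fin E in \<open>auto simp: link_def\<close>)
    have link: "X \<subseteq> verts G \<and> card X = r - 1 \<and> finite X" if "X \<in> link (edges G) y" for X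
      using that E fin by (fastforce simp: link_def dest: finite_subset)
    then show "card X \<le> r - 1 \<and> finite X" if "X \<in> link (edges G) y" for X
      using that by auto
    show "card {X \<in> link (edges G) y. x \<in> X} \<le> n ^ (r - 2)" for x
    proof -
      have "card {X \<in> link (edges G) y. x \<in> X} \<le> card {X. X \<subseteq> verts G \<and> card X = r - 1 \<and> x \<in> X}"
        by (rule card_mono[OF finite_subset[of _ "Pow (verts G)"]]) (use fin link in auto)
      also have "\<dots> \<le> n ^ (r - 2)"
        using card_subsets_containing_le_power[OF fin, of "r - 1" x] \<open>card (verts G) = n\<close>
        by (simp add: numeral_2_eq_2)
      finally show ?thesis .
    qed
  qed simp
  \<comment> \<open>The bound is linear in the \<open>t\<close>-th power, so it can be summed over
    vertices of different degrees. If \<open>d y < a\<close>, the truncated difference is 0 and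
    \<open>real a\<close> alone suffices.\<close>
  have vertex: "real (d y) \<le> real a + (m + real ((d y - a) ^ t) / m ^ (t - 1))" for y
    using le_add_power_divide_power[of "real (d y - a)" m t] mpos \<open>t \<ge> 1\<close> by simp
  have "(\<Sum>y\<in>verts G. (d y - a) ^ t) \<le> (\<Sum>y\<in>verts G. card (disjoint_tuples (link (edges G) y) t))"
    by (rule sum_mono) (rule tuples)
  also have "\<dots> \<le> s * n ^ ((r - 1) * t)"
    using sum_card_disjoint_tuples_link_le[of r s t G] assms by simp
  finally have tuples_sum: "(\<Sum>y\<in>verts G. real ((d y - a) ^ t)) \<le> real s * real n ^ ((r - 1) * t)"
    by (metis of_nat_le_iff of_nat_mult of_nat_power of_nat_sum)
  have "real (card (edges G)) \<le> (\<Sum>y\<in>verts G. real (d y))"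
    using card_edges_le_sum_link[OF G] \<open>r \<ge> 2\<close> unfolding d_def
    by (metis One_nat_def Suc_1 Suc_leD of_nat_le_iff of_nat_sum)
  also have "\<dots> \<le> (\<Sum>y\<in>verts G. real a + (m + real ((d y - a) ^ t) / m ^ (t - 1)))"
    by (rule sum_mono) (rule vertex)
  also have "\<dots> = real n * real a + real n * m + (\<Sum>y\<in>verts G. real ((d y - a) ^ t)) / m ^ (t - 1)"
    using \<open>card (verts G) = n\<close> by (simp add: sum.distrib sum_divide_distrib)
  also have "\<dots> \<le> real n * real a + real n * m + real s * (real n ^ ((r - 1) * t) / m ^ (t - 1))"
    using tuples_sum mpos by (simp add: divide_right_mono)
  \<comment> \<open>The left side has order \<open>n ^ (r - 1)\<close>, and
    \<open>r - 1 \<le> p\<close> because \<open>1 / t \<le> 1\<close>.\<close>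
  also have "real n * real a \<le> real (t * r) * real n powr p"
  proof -
    have "real n * real a = real (t * (r - 1)) * (real n * real n ^ (r - 2))"
      by (simp add: a_def)
    also have "real n * real n ^ (r - 2) = real n powr (real r - 1)"
      using assms by (simp add: powr_realpow[symmetric] powr_mult_base of_nat_diff)
    also have "\<dots> \<le> real n powr p"
      using \<open>n \<ge> 1\<close> \<open>t \<ge> 1\<close> by (intro powr_mono) (auto simp: p_def)
    also have "real (t * (r - 1)) * real n powr p \<le> real (t * r) * real n powr p"
      by (intro mult_right_mono of_nat_mono mult_left_mono) auto
    finally show ?thesis
      by (simp add: mult_left_mono)
  qed
  also have "real n * m = real n powr p"
    using \<open>n \<ge> 1\<close> by (simp add: m_def powr_mult_base)
  \<comment> \<open>Since \<open>p - 1 = (r - 1) - 1 / t\<close>, the exponent is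
    \<open>(r - 1) + (t - 1) / t\<close>, which equals \<open>p\<close>.\<close>
  also have "real n ^ ((r - 1) * t) / m ^ (t - 1) = real n powr p"
  proof -
    have "real n ^ ((r - 1) * t) = real n powr ((real r - 1) * real t)"
      using assms by (simp add: powr_realpow[symmetric] of_nat_diff)
    moreover have "m ^ (t - 1) = real n powr ((p - 1) * (real t - 1))"
      using assms by (simp add: m_def powr_realpow[symmetric] powr_powr of_nat_diff)
    moreover have "(real r - 1) * real t - (p - 1) * (real t - 1) = p"
      using \<open>t \<ge> 1\<close> by (simp add: p_def field_simps)
    ultimately show ?thesis
      by (metis powr_diff)
  qed
  finally show ?thesis
    by (simp add: p_def algebra_simps)
qed

theorem theorem1p3:
  fixes r s t :: nat
  assumes "r \<ge> 3" and "t \<ge> 2" and "s \<ge> t"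
  shows "(\<lambda>n::nat. real (turan_number r n (complete_bipartite r s t)))
           \<in> O(\<lambda>n. real n powr (real r - 1 / real t))"
proof (rule bigoI[of _ "real (t * r + s + 1)"])
  \<comment> \<open>With an edge to embed, the edgeless hypergraph on \<open>n\<close> vertices is
    an admissible host, so the maximum is attained by some hypergraph.\<close>
  have "part_X r 0 \<union> {Inr 0} \<in> edges (complete_bipartite r s t)"
    unfolding complete_bipartite_def part_Y_def snd_conv mem_Collect_eq
    by (rule exI[of _ 0], rule exI[of _ "Inr 0"]) (use assms in simp)
  then have "edges (complete_bipartite r s t) \<noteq> {}"
    by blast
  note max = Max_in[OF finite_turan_set turan_set_nonempty[OF this], folded turan_number_def]
  have "real (turan_number r n (complete_bipartite r s t))
      \<le> real (t * r + s + 1) * real n powr (real r - 1 / real t)" if "n \<ge> 1" for n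
  proof -
    obtain G :: "nat hypergraph" where
      "turan_number r n (complete_bipartite r s t) = card (edges G)" "r_graph r G"
      "card (verts G) = n" "\<not> contains_copy G (complete_bipartite r s t)"
      using max[of r n] by blast
    then show ?thesis
      using card_edges_le_if_complete_bipartite_free[of r s t G n] assms that by simp
  qed
  then show "eventually (\<lambda>n. norm (real (turan_number r n (complete_bipartite r s t)))
      \<le> real (t * r + s + 1) * norm (real n powr (real r - 1 / real t))) sequentially"
    by (intro eventually_sequentiallyI[of 1]) simp
qed

end
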